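(* Let $M_1$ and $M_2$ be Orlicz functions. Suppose that for $i\in\{1,2\}$, $M_i$ is $\mathcal{C}^3$ on $[0,+\infty)$, $M_i^{(3)}$ is increasing, $M_i(t)=o(t^3)$ when $t\to 0$, and $M_i$ satisfies the $\Delta_{2++}$-condition at $0$. Let $X=\ell_{M_1}$ or $X=\ell_{M_1}^n$ for some $n\in\mathbb{N}$. Then for every $\varepsilon>0$, there exists $\delta>0$ such that for every $T\in\operatorname{Emb}_{1+\delta}(X,\ell_{M_2})$ and every disjoint $f,g\in X$, there exist disjoint $\widetilde f,\widetilde g\in\ell_{M_2}$ such that $\|T(f)-\widetilde f\|\leqslant\varepsilon$ and $\|T(g)-\widetilde g\|\leqslant\varepsilon$.
   Context: All spaces are real. An Orlicz function is a convex function $M\colon[0,+\infty)\to[0,+\infty)$ with $M(0)=0$ and $\lim_{t\to\infty}M(t)=\infty$. For a real sequence $x=(x(k))_{k\in\mathbb{N}}$, the Luxemburg norm is $\|x\|_M=\inf\{\rho>0 : \sum_k M(|x(k)|/\rho)\leqslant 1\}$ (with $\inf\varnothing=+\infty$); the Orlicz sequence space is $\ell_M=\{x\in\mathbb{R}^{\mathbb{N}} : \|x\|_M<\infty\}$ with the norm $\|\cdot\|=\|\cdot\|_M$. The space $\ell_M^n$ is $\mathbb{R}^n$ with the norm defined in the same way on sequences indexed by $\{1,\dots,n\}$. The support of $x$ is $\{k : x(k)\neq 0\}$; two vectors are disjoint if their supports are disjoint. An Orlicz function $M$ of class $\mathcal{C}^3$ on $(0,+\infty)$ satisfies the $\Delta_{2++}$-condition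 at $0$ if for every $i\in\{1,2,3\}$, $\limsup_{t\to 0}\frac{tM^{(i)}(t)}{M^{(i-1)}(t)}<\infty$. For Banach spaces $X,Y$ and $C\geqslant 1$, $\operatorname{Emb}_C(X,Y)$ is the set of all linear injections $T\colon X\to Y$ with $\max(\|T\|,\|T^{-1}\|)\leqslant C$, where $T^{-1}$ is defined on the range $T(X)$.
   Formalization: The disjoint f, g are taken in the unit ball of X: for unbounded f, g with an absolute error ε the claim fails (M_1=M_2=t^4, X=ℓ_4^2, Te_1=e_1+ηe_2, Te_2=e_2, f=λe_1, g=λe_2, λ→∞). *)

theory Defs
  imports "HOL-Analysis.Analysis" "HOL-Library.Landau_Symbols"
begin

text \<open>Functions on \<open>[0,+\<infinity>)\<close> are modelled as functions on \<^typ>\<open>real\<close> whose values at negative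
  arguments are never used; in particular all derivatives below are taken within \<open>{0..}\<close>.\<close>

definition orlicz_function :: "(real \<Rightarrow> real) \<Rightarrow> bool" where
  "orlicz_function M \<longleftrightarrow>
     convex_on {0..} M \<and> (\<forall>t\<ge>0. M t \<ge> 0) \<and> M 0 = 0 \<and> filterlim M at_top at_top"

text \<open>The \<open>i\<close>-th derivative on \<open>[0,+\<infinity>)\<close>: one-sided at 0, and the ordinary two-sided derivative
  at every \<open>t > 0\<close>.\<close>

fun hderiv :: "nat \<Rightarrow> (real \<Rightarrow> real) \<Rightarrow> real \<Rightarrow> real" where
  "hderiv 0 M = M"
| "hderiv (Suc i) M = (\<lambda>t. vector_derivative (hderiv i M) (at t within {0..}))"

definition C_halfline :: "nat \<Rightarrow> (real \<Rightarrow> real) \<Rightarrow> bool" where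
  "C_halfline k M \<longleftrightarrow>
     (\<forall>i<k. hderiv i M differentiable_on {0..}) \<and> continuous_on {0..} (hderiv k M)"

text \<open>The condition \<open>limsup\<^sub>t\<^sub>\<rightarrow>\<^sub>0 t M\<^sup>(\<^sup>i\<^sup>)(t) / M\<^sup>(\<^sup>i\<^sup>-\<^sup>1\<^sup>)(t) < \<infinity>\<close> presupposes that the denominators do
  not vanish near 0. This has to be said explicitly because \<open>x / 0 = 0\<close> in HOL: without it, an
  Orlicz function vanishing on a neighbourhood of 0 would satisfy the condition.\<close>

definition Delta2pp_at_0 :: "(real \<Rightarrow> real) \<Rightarrow> bool" where
  "Delta2pp_at_0 M \<longleftrightarrow>
     (\<forall>i\<in>{1,2,3}.
        (\<forall>\<^sub>F t in at_right 0. hderiv (i - 1) M t \<noteq> 0) \<and>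
        Limsup (at_right 0) (\<lambda>t. ereal (t * hderiv i M t / hderiv (i - 1) M t)) < \<infinity>)"

text \<open>The Luxemburg norm of a family indexed by \<open>I\<close>. It takes values in \<open>[0,+\<infinity>]\<close>, with
  \<open>Inf {} = \<infinity>\<close>; the inner sum is a sum of nonnegative terms in \<open>[0,+\<infinity>]\<close>.\<close>

definition lux_norm :: "(real \<Rightarrow> real) \<Rightarrow> 'i set \<Rightarrow> ('i \<Rightarrow> real) \<Rightarrow> ennreal" where
  "lux_norm M I x =
     Inf {ennreal \<rho> | \<rho>. \<rho> > 0 \<and> (\<Sum>\<^sub>\<infinity>k\<in>I. ennreal (M (\<bar>x k\<bar> / \<rho>))) \<le> 1}"

text \<open>A family indexed by \<open>I\<close> is represented by its extension by 0. Thus \<open>orlicz_space M UNIV\<close>, with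
  \<open>UNIV :: nat set\<close>, is \<open>\<ell>\<^sub>M\<close>, and \<open>orlicz_space M {1..n}\<close> is \<open>\<ell>\<^sub>M\<^sup>n\<close>.\<close>

definition orlicz_space :: "(real \<Rightarrow> real) \<Rightarrow> 'i set \<Rightarrow> ('i \<Rightarrow> real) set" where
  "orlicz_space M I = {x. (\<forall>k. k \<notin> I \<longrightarrow> x k = 0) \<and> lux_norm M I x < \<infinity>}"

definition support :: "('i \<Rightarrow> real) \<Rightarrow> 'i set" where
  "support x = {k. x k \<noteq> 0}"

definition disjoint_vec :: "('i \<Rightarrow> real) \<Rightarrow> ('i \<Rightarrow> real) \<Rightarrow> bool" where
  "disjoint_vec x y \<longleftrightarrow> support x \<inter> support y = {}"

text \<open>Normed spaces of families are given by a carrier \<open>X\<close> and a norm \<open>p\<close> on it.\<close>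

definition linear_map_on :: "('i \<Rightarrow> real) set \<Rightarrow> (('i \<Rightarrow> real) \<Rightarrow> ('j \<Rightarrow> real)) \<Rightarrow> bool" where
  "linear_map_on X T \<longleftrightarrow>
     (\<forall>x\<in>X. \<forall>y\<in>X. T (\<lambda>k. x k + y k) = (\<lambda>j. T x j + T y j)) \<and>
     (\<forall>a. \<forall>x\<in>X. T (\<lambda>k. a * x k) = (\<lambda>j. a * T x j))"

definition op_norm :: "'a set \<Rightarrow> ('a \<Rightarrow> ennreal) \<Rightarrow> ('b \<Rightarrow> ennreal) \<Rightarrow> ('a \<Rightarrow> 'b) \<Rightarrow> ennreal" where
  "op_norm X p q T = (SUP x\<in>{x\<in>X. p x \<le> 1}. q (T x))"

definition Emb ::
  "real \<Rightarrow> ('i \<Rightarrow> real) set \<Rightarrow> (('i \<Rightarrow> real) \<Rightarrow> ennreal) \<Rightarrow>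
   ('j \<Rightarrow> real) set \<Rightarrow> (('j \<Rightarrow> real) \<Rightarrow> ennreal) \<Rightarrow> (('i \<Rightarrow> real) \<Rightarrow> ('j \<Rightarrow> real)) set" where
  "Emb C X p Y q =
     {T. T ` X \<subseteq> Y \<and> linear_map_on X T \<and> inj_on T X \<and>
         max (op_norm X p q T) (op_norm (T ` X) q p (inv_into X T)) \<le> ennreal C}"

end

theory Submission
  imports Defs
begin

text \<open>
  The proof plays a third-order effect in the domain against a second-order effect in the range.

  The hypotheses on the third derivative make \<open>M t / t ^ 3\<close> nondecreasing, so that
  \<open>M (t * s) \<le> t ^ 3 * M s\<close> for \<open>t \<le> 1\<close> (\<open>cubic_scale\<close>). Hence disjoint vectors \<open>f, g\<close> of the unit ball
  of \<open>\<ell>\<^bsub>M\<^esub>\<close> satisfy \<open>\<parallel>f \<plusminus> t g\<parallel> \<le> 1 + t ^ 3\<close> (\<open>lux_norm_disjoint_sum\<close>). On the other hand, overlap costs a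
  second-order term: for \<open>b \<le> a\<close> the second difference \<open>M (a + t b) + M (a - t b) - 2 M a\<close> is at
  least \<open>t\<^sup>2 M b\<close> (\<open>second_difference\<close>).

  Let \<open>f, g\<close> be disjoint of norm one, let \<open>u = T f\<close> and \<open>v = T g\<close>, and let \<open>T\<close> and its inverse have norm at
  most \<open>1 + t ^ 3\<close>. Then \<open>u\<close> has norm at least \<open>1 / (1 + t ^ 3)\<close>, while \<open>u + t v\<close> and \<open>u - t v\<close> have norm at
  most \<open>(1 + t ^ 3)\<^sup>2\<close>. The sum of the second differences over all coordinates is therefore
  \<open>O(t ^ 3)\<close>, where the doubling condition turns estimates of norms into estimates of modulars.
  Dividing by \<open>t\<^sup>2\<close>, the modular of \<open>v\<close> on the set where \<open>\<bar>v\<bar> \<le> \<bar>u\<bar>\<close> is \<open>O(t)\<close>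
  (\<open>overlap_estimate\<close>). The two vectors play symmetric roles, so \<open>min \<bar>u\<bar> \<bar>v\<bar>\<close> has modular \<open>O(t)\<close>; the
  doubling condition, used once more, makes its norm at most \<open>\<epsilon>\<close> for small \<open>t\<close>. Keeping at each
  coordinate only the larger of \<open>u\<close> and \<open>v\<close> then gives disjoint vectors that differ from \<open>u\<close> and
  \<open>v\<close> by at most \<open>min \<bar>u\<bar> \<bar>v\<bar>\<close> (\<open>almost_disjoint_images\<close>).

  General \<open>f, g\<close> of norm at most one reduce to norm one by homogeneity, unless one of them has
  norm zero; its image is then approximated by 0.
\<close>

section \<open>One-sided calculus\<close>

text \<open>The Taylor-type bounds below are obtained by integrating an inequality between
  derivatives. Derivatives within the interval are what the one-sided derivatives at 0 provide.\<close>

lemma le_of_derivative_le: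
  fixes f g f' g' :: "real \<Rightarrow> real"
  assumes "\<And>s. s \<in> {x..y} \<Longrightarrow> (f has_real_derivative f' s) (at s within {x..y})"
    and "\<And>s. s \<in> {x..y} \<Longrightarrow> (g has_real_derivative g' s) (at s within {x..y})"
    and "\<And>s. s \<in> {x..y} \<Longrightarrow> f' s \<le> g' s"
    and "x \<le> y" and "f x \<le> g x"
  shows "f y \<le> g y"
proof -
  have "\<exists>\<xi>\<in>{x..y}. (g y - f y) - (g x - f x) = (\<lambda>d. d * (g' \<xi> - f' \<xi>)) (y - x)"
  proof (rule mvt_very_simple[OF \<open>x \<le> y\<close>])
    fix s assume "x \<le> s" "s \<le> y"
    then have "((\<lambda>s. g s - f s) has_real_derivative g' s - f' s) (at s within {x..y})"
      by (intro DERIV_diff assms) auto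
    then show "((\<lambda>s. g s - f s) has_derivative (\<lambda>d. d * (g' s - f' s))) (at s within {x..y})"
      by (simp add: has_field_derivative_def mult_commute_abs)
  qed
  then obtain \<xi> where "\<xi> \<in> {x..y}" and "(g y - f y) - (g x - f x) = (y - x) * (g' \<xi> - f' \<xi>)"
    by auto
  moreover have "(y - x) * (g' \<xi> - f' \<xi>) \<ge> 0"
    using assms(3)[OF \<open>\<xi> \<in> {x..y}\<close>] \<open>x \<le> y\<close> by simp
  ultimately show ?thesis using \<open>f x \<le> g x\<close> by linarith
qed

lemma power_lower_bound_integrate:
  fixes f f' :: "real \<Rightarrow> real"
  assumes "\<And>s. s \<ge> 0 \<Longrightarrow> (f has_real_derivative f' s) (at s within {0..})"
    and "f 0 = 0" and "\<forall>s\<in>{0..a}. c * s ^ n \<le> f' s"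
  shows "\<forall>s\<in>{0..a}. c / real (Suc n) * s ^ Suc n \<le> f s"
proof
  fix s assume s: "s \<in> {0..a}"
  show "c / real (Suc n) * s ^ Suc n \<le> f s"
  proof (rule le_of_derivative_le[where x = 0 and f = "\<lambda>s. c / real (Suc n) * s ^ Suc n"
      and f' = "\<lambda>s. c * s ^ n" and g = f and g' = f'])
  fix \<sigma> assume \<sigma>: "\<sigma> \<in> {0..s}"
  show "((\<lambda>s. c / real (Suc n) * s ^ Suc n) has_real_derivative c * \<sigma> ^ n) (at \<sigma> within {0..s})"
    by (rule derivative_eq_intros refl | simp)+
  show "(f has_real_derivative f' \<sigma>) (at \<sigma> within {0..s})"
    using \<sigma> by (intro DERIV_subset[OF assms(1)]) auto
  show "c * \<sigma> ^ n \<le> f' \<sigma>" using \<sigma> assms(3) s by auto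
  qed (use assms s in auto)
qed

lemma positive_bound_near_0:
  fixes f :: "real \<Rightarrow> real"
  assumes "continuous_on {0..} f" and "f 0 > 0"
  obtains c a where "c > 0" "a > 0" "\<And>s. s \<in> {0..a} \<Longrightarrow> c \<le> f s"
proof -
  obtain d where d: "d > 0" "\<And>s. s \<in> {0..} \<Longrightarrow> dist s 0 < d \<Longrightarrow> dist (f s) (f 0) < f 0 / 2"
    using assms unfolding continuous_on_iff by (metis atLeast_iff half_gt_zero order_refl)
  show thesis
  proof
    show "f 0 / 2 > 0" "d / 2 > 0" using assms d by auto
    fix s assume "s \<in> {0..d / 2}"
    then show "f 0 / 2 \<le> f s" using d(2)[of s] \<open>d > 0\<close> by (auto simp: dist_real_def abs_if split: if_splits)
  qed
qed

lemma hderiv_has_derivative: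
  assumes "C_halfline k M" "i < k" "s \<ge> 0"
  shows "(hderiv i M has_real_derivative hderiv (Suc i) M s) (at s within {0..})"
proof -
  have "hderiv i M differentiable (at s within {0..})"
    using assms by (auto simp: C_halfline_def differentiable_on_def)
  then show ?thesis
    by (simp add: vector_derivative_works has_real_derivative_iff_has_vector_derivative)
qed

section \<open>Orlicz functions with increasing third derivative\<close>

lemma orlicz_scale_le:
  assumes "orlicz_function M" "0 \<le> c" "c \<le> 1" "0 \<le> s"
  shows "M (c * s) \<le> c * M s"
  using convex_onD[of "{0..}" M c 0 s] assms by (auto simp: orlicz_function_def)

lemma orlicz_mono:
  assumes "orlicz_function M" "0 \<le> s" "s \<le> s'"
  shows "M s \<le> M s'"
proof (cases "s' = 0")
  case False
  have "M (s / s' * s') \<le> s / s' * M s'"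
    using assms False by (intro orlicz_scale_le) auto
  also have "\<dots> \<le> 1 * M s'"
    using assms False by (intro mult_right_mono) (auto simp: orlicz_function_def)
  finally show ?thesis using False by simp
qed (use assms in auto)

lemma orlicz_nonneg: "orlicz_function M \<Longrightarrow> 0 \<le> s \<Longrightarrow> 0 \<le> M s"
  by (simp add: orlicz_function_def)

text \<open>The one-sided derivatives enter as arbitrary functions, so that the calculus below does not
  have to go through \<^const>\<open>hderiv\<close>.\<close>

locale cubic_orlicz =
  fixes M D1 D2 D3 :: "real \<Rightarrow> real"
  assumes orlicz: "orlicz_function M"
    and D1: "\<And>s. s \<ge> 0 \<Longrightarrow> (M has_real_derivative D1 s) (at s within {0..})"
    and D2: "\<And>s. s \<ge> 0 \<Longrightarrow> (D1 has_real_derivative D2 s) (at s within {0..})"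
    and D3: "\<And>s. s \<ge> 0 \<Longrightarrow> (D2 has_real_derivative D3 s) (at s within {0..})"
    and cont_D3: "continuous_on {0..} D3"
    and mono_D3: "mono_on {0..} D3"
    and small: "M \<in> o[at_right 0](\<lambda>t. t ^ 3)"
begin

lemma not_quadratic_growth:
  assumes "c > 0" "a > 0" "\<forall>s\<in>{0..a}. c * s\<^sup>2 \<le> M s"
  shows False
proof -
  have "eventually (\<lambda>s. norm (M s) \<le> 1 * norm (s ^ 3)) (at_right 0)"
    using small by (rule landau_o.smallD) simp
  then obtain b where b: "b > 0" "\<And>s. 0 < s \<Longrightarrow> s < b \<Longrightarrow> \<bar>M s\<bar> \<le> s ^ 3"
    by (auto simp: eventually_at_right_field)
  define s where "s = min a (min (b / 2) (c / 2))"
  have s: "0 < s" "s \<le> a" "s < b" "s < c" using assms(1,2) b by (auto simp: s_def min_def)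
  have "c * s\<^sup>2 \<le> s ^ 3" using bspec[OF assms(3), of s] b(2)[of s] s by simp
  then have "s\<^sup>2 * c \<le> s\<^sup>2 * s" by (simp add: power2_eq_square power3_eq_cube mult_ac)
  then show False using s by (simp add: mult_le_cancel_left)
qed

lemma M_nonneg: "0 \<le> s \<Longrightarrow> 0 \<le> M s" and M_0: "M 0 = 0"
  using orlicz by (auto simp: orlicz_function_def)

lemma not_negative_near_0:
  assumes "c > 0" "a > 0" "\<forall>s\<in>{0..a}. c * s ^ n \<le> - M s"
  shows False
proof -
  have "0 < c * a ^ n" using assms by simp
  also have "\<dots> \<le> - M a" using assms by auto
  finally show False using M_nonneg[of a] assms by simp
qed

lemma neg_D: 
  shows "s \<ge> 0 \<Longrightarrow> ((\<lambda>s. - M s) has_real_derivative - D1 s) (at s within {0..})"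
    and "s \<ge> 0 \<Longrightarrow> ((\<lambda>s. - D1 s) has_real_derivative - D2 s) (at s within {0..})"
    and "s \<ge> 0 \<Longrightarrow> ((\<lambda>s. - D2 s) has_real_derivative - D3 s) (at s within {0..})"
  by (auto intro!: DERIV_minus D1 D2 D3)

text \<open>The little-o condition forces the Taylor coefficients of orders 1 and 2 at 0 to vanish. A
  nonzero coefficient, once integrated back up to \<open>M\<close>, would give growth at least quadratic if it
  were positive and negative values of \<open>M\<close> if it were negative.\<close>

lemma D1_0: "D1 0 = 0"
proof (rule antisym)
  have cont: "continuous_on {0..} D1" using D2 by (auto intro!: DERIV_continuous_on)
  show "D1 0 \<le> 0"
  proof (rule ccontr)
    assume "\<not> D1 0 \<le> 0"
    then obtain c a where ca: "c > 0" "a > 0" "\<And>s. s \<in> {0..a} \<Longrightarrow> c \<le> D1 s"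
      using positive_bound_near_0[OF cont] by auto
    \<comment> \<open>On \<open>[0,1]\<close> a constant lower bound is weakened to a linear one, so that linear growth counts
       as quadratic growth.\<close>
    have "\<forall>s\<in>{0..min a 1}. c * s ^ 1 \<le> D1 s"
    proof
      fix s assume s: "s \<in> {0..min a 1}"
      then have "c * s \<le> c * 1" using ca(1) by (intro mult_left_mono) auto
      then show "c * s ^ 1 \<le> D1 s" using ca(3)[of s] s by simp
    qed
    from power_lower_bound_integrate[OF D1 M_0 this]
    have "\<forall>s\<in>{0..min a 1}. c / 2 * s\<^sup>2 \<le> M s"
      by (simp add: power2_eq_square)
    with not_quadratic_growth[of "c / 2" "min a 1"] ca show False by auto
  qed
  show "0 \<le> D1 0"
  proof (rule ccontr)
    assume "\<not> 0 \<le> D1 0"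
    then obtain c a where ca: "c > 0" "a > 0" "\<And>s. s \<in> {0..a} \<Longrightarrow> c \<le> - D1 s"
      using positive_bound_near_0[of "\<lambda>s. - D1 s"] cont by (auto intro: continuous_on_minus)
    have "\<forall>s\<in>{0..a}. c * s ^ 0 \<le> - D1 s" using ca(3) by simp
    from power_lower_bound_integrate[OF neg_D(1) _ this]
    have "\<forall>s\<in>{0..a}. c * s ^ 1 \<le> - M s" using M_0 by simp
    with not_negative_near_0[of c a 1] ca show False by auto
  qed
qed

lemma D2_0: "D2 0 = 0"
proof (rule antisym)
  have cont: "continuous_on {0..} D2" using D3 by (auto intro!: DERIV_continuous_on)
  show "D2 0 \<le> 0"
  proof (rule ccontr)
    assume "\<not> D2 0 \<le> 0"
    then obtain c a where ca: "c > 0" "a > 0" "\<And>s. s \<in> {0..a} \<Longrightarrow> c \<le> D2 s"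
      using positive_bound_near_0[OF cont] by auto
    have "\<forall>s\<in>{0..a}. c * s ^ 0 \<le> D2 s" using ca(3) by simp
    from power_lower_bound_integrate[OF D2 D1_0 this]
    have "\<forall>s\<in>{0..a}. c * s ^ 1 \<le> D1 s" by simp
    from power_lower_bound_integrate[OF D1 M_0 this]
    have "\<forall>s\<in>{0..a}. c / 2 * s\<^sup>2 \<le> M s"
      by (simp add: power2_eq_square)
    with not_quadratic_growth[of "c / 2" a] ca show False by auto
  qed
  show "0 \<le> D2 0"
  proof (rule ccontr)
    assume "\<not> 0 \<le> D2 0"
    then obtain c a where ca: "c > 0" "a > 0" "\<And>s. s \<in> {0..a} \<Longrightarrow> c \<le> - D2 s"
      using positive_bound_near_0[of "\<lambda>s. - D2 s"] cont by (auto intro: continuous_on_minus)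
    have "\<forall>s\<in>{0..a}. c * s ^ 0 \<le> - D2 s" using ca(3) by simp
    from power_lower_bound_integrate[OF neg_D(2) _ this]
    have "\<forall>s\<in>{0..a}. c * s ^ 1 \<le> - D1 s" using D1_0 by simp
    from power_lower_bound_integrate[OF neg_D(1) _ this]
    have "\<forall>s\<in>{0..a}. c / 2 * s ^ 2 \<le> - M s" using M_0 by (simp add: power2_eq_square)
    with not_negative_near_0[of "c / 2" a 2] ca show False by auto
  qed
qed

text \<open>A negative third derivative at 0 would make \<open>M\<close> negative near 0, since the lower
  coefficients vanish; monotonicity does the rest.\<close>

lemma D3_nonneg:
  assumes "s \<ge> 0"
  shows "D3 s \<ge> 0"
proof -
  have "D3 0 \<ge> 0"
  proof (rule ccontr)
    assume "\<not> 0 \<le> D3 0"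
    then obtain c a where ca: "c > 0" "a > 0" "\<And>s. s \<in> {0..a} \<Longrightarrow> c \<le> - D3 s"
      using positive_bound_near_0[of "\<lambda>s. - D3 s"] cont_D3 by (auto intro: continuous_on_minus)
    have "\<forall>s\<in>{0..a}. c * s ^ 0 \<le> - D3 s" using ca(3) by simp
    from power_lower_bound_integrate[OF neg_D(3) _ this]
    have "\<forall>s\<in>{0..a}. c * s ^ 1 \<le> - D2 s" using D2_0 by simp
    from power_lower_bound_integrate[OF neg_D(2) _ this]
    have "\<forall>s\<in>{0..a}. c / 2 * s ^ 2 \<le> - D1 s" using D1_0 by (simp add: power2_eq_square)
    from power_lower_bound_integrate[OF neg_D(1) _ this]
    have "\<forall>s\<in>{0..a}. c / 6 * s ^ 3 \<le> - M s"
      using M_0 by (simp add: power3_eq_cube power2_eq_square)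
    with not_negative_near_0[of "c / 6" a 3] ca show False by auto
  qed
  also have "D3 0 \<le> D3 s" using mono_onD[OF mono_D3] assms by auto
  finally show ?thesis .
qed

lemma D_within:
  assumes "0 \<le> x" "s \<in> {x..y}"
  shows "(M has_real_derivative D1 s) (at s within {x..y})"
    "(D1 has_real_derivative D2 s) (at s within {x..y})"
    "(D2 has_real_derivative D3 s) (at s within {x..y})"
  using assms by (auto intro!: DERIV_subset[OF D1] DERIV_subset[OF D2] DERIV_subset[OF D3])

lemma D2_mono: "0 \<le> x \<Longrightarrow> x \<le> y \<Longrightarrow> D2 x \<le> D2 y"
  by (rule le_of_derivative_le[where f = "\<lambda>_. D2 x" and f' = "\<lambda>_. 0" and g' = D3 and x = x])
     (auto intro!: D_within D3_nonneg)

lemma D2_nonneg: "0 \<le> s \<Longrightarrow> 0 \<le> D2 s"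
  using D2_mono[of 0 s] D2_0 by simp

lemma D1_mono: "0 \<le> x \<Longrightarrow> x \<le> y \<Longrightarrow> D1 x \<le> D1 y"
  by (rule le_of_derivative_le[where f = "\<lambda>_. D1 x" and f' = "\<lambda>_. 0" and g' = D2 and x = x])
     (auto intro!: D_within D2_nonneg)

lemma M_le_D2: 
  assumes "0 \<le> b"
  shows "M b \<le> b\<^sup>2 / 2 * D2 b"
proof -
  have 1: "D1 s \<le> s * D2 b" if s: "s \<in> {0..b}" for s
  proof (rule le_of_derivative_le[where f = D1 and f' = D2 and g = "\<lambda>s. s * D2 b"
        and g' = "\<lambda>_. D2 b" and x = 0])
    fix \<sigma> assume \<sigma>: "\<sigma> \<in> {0..s}"
    show "((\<lambda>s. s * D2 b) has_real_derivative D2 b) (at \<sigma> within {0..s})"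
      by (rule derivative_eq_intros refl | simp)+
  qed (use s D1_0 in \<open>auto intro!: D_within D2_mono\<close>)
  show ?thesis
  proof (rule le_of_derivative_le[where f = M and f' = D1 and g = "\<lambda>s. s\<^sup>2 / 2 * D2 b"
        and g' = "\<lambda>s. s * D2 b" and x = 0])
    fix \<sigma> assume \<sigma>: "\<sigma> \<in> {0..b}"
    show "((\<lambda>s. s\<^sup>2 / 2 * D2 b) has_real_derivative \<sigma> * D2 b) (at \<sigma> within {0..b})"
      by (rule derivative_eq_intros refl | simp)+
  qed (use assms M_0 1 in \<open>auto intro!: D_within\<close>)
qed

lemma M_tangent:
  assumes "0 \<le> h" "h \<le> a"
  shows "M a - h * D1 a \<le> M (a - h)"
proof -
  have "M a \<le> M (a - h) + (a - (a - h)) * D1 a"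
  proof (rule le_of_derivative_le[where f = M and f' = D1 and x = "a - h"
        and g = "\<lambda>s. M (a - h) + (s - (a - h)) * D1 a" and g' = "\<lambda>_. D1 a"])
    fix \<sigma> assume "\<sigma> \<in> {a - h..a}"
    show "((\<lambda>s. M (a - h) + (s - (a - h)) * D1 a) has_real_derivative D1 a) (at \<sigma> within {a - h..a})"
      by (rule derivative_eq_intros refl | simp)+
  qed (use assms in \<open>auto intro!: D_within D1_mono\<close>)
  then show ?thesis by simp
qed

lemma M_taylor2:
  assumes "0 \<le> h" "0 \<le> a"
  shows "M a + h * D1 a + h\<^sup>2 / 2 * D2 a \<le> M (a + h)"
proof -
  have 1: "D1 a + (s - a) * D2 a \<le> D1 s" if s: "s \<in> {a..a+h}" for s
  proof (rule le_of_derivative_le[where g = D1 and g' = D2 and f = "\<lambda>s. D1 a + (s - a) * D2 a"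
        and f' = "\<lambda>_. D2 a" and x = a])
    fix \<sigma> assume "\<sigma> \<in> {a..s}"
    show "((\<lambda>s. D1 a + (s - a) * D2 a) has_real_derivative D2 a) (at \<sigma> within {a..s})"
      by (rule derivative_eq_intros refl | simp)+
  qed (use s assms in \<open>auto intro!: D_within D2_mono\<close>)
  have "M a + (a + h - a) * D1 a + (a + h - a)\<^sup>2 / 2 * D2 a \<le> M (a + h)"
  proof (rule le_of_derivative_le[where g = M and g' = D1 and x = a
      and f = "\<lambda>s. M a + (s - a) * D1 a + (s - a)\<^sup>2 / 2 * D2 a"
      and f' = "\<lambda>s. D1 a + (s - a) * D2 a"])
    fix \<sigma> assume "\<sigma> \<in> {a..a+h}"
    show "((\<lambda>s. M a + (s - a) * D1 a + (s - a)\<^sup>2 / 2 * D2 a) has_real_derivative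
            D1 a + (\<sigma> - a) * D2 a) (at \<sigma> within {a..a+h})"
      by (rule derivative_eq_intros refl | simp)+
  qed (use assms 1 in \<open>auto intro!: D_within\<close>)
  then show ?thesis by simp
qed

text \<open>To the right of \<open>a\<close>, \<open>M\<close> exceeds its tangent at \<open>a\<close> by at least \<open>(t * b)\<^sup>2 / 2 * D2 a\<close>; to the left
  it lies above the tangent. As \<open>D2\<close> is nondecreasing, \<open>D2 a\<close> is at least \<open>D2 b\<close>, and
  \<open>b\<^sup>2 / 2 * D2 b\<close> dominates \<open>M b\<close>.\<close>

lemma second_difference:
  assumes "0 \<le> b" "b \<le> a" "0 \<le> t" "t \<le> 1"
  shows "2 * M a + t\<^sup>2 * M b \<le> M (a + t * b) + M (a - t * b)"
proof -
  have tb: "0 \<le> t * b" "t * b \<le> a" using assms mult_left_le_one_le[of b t] by auto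
  have "t\<^sup>2 * M b \<le> t\<^sup>2 * (b\<^sup>2 / 2 * D2 a)"
  proof (rule mult_left_mono)
    have "b\<^sup>2 / 2 * D2 b \<le> b\<^sup>2 / 2 * D2 a" using D2_mono[of b a] assms by (intro mult_left_mono) auto
    then show "M b \<le> b\<^sup>2 / 2 * D2 a" using M_le_D2[of b] assms by linarith
  qed simp
  then have "t\<^sup>2 * M b \<le> (t * b)\<^sup>2 / 2 * D2 a" by (simp add: power_mult_distrib)
  then show ?thesis using M_tangent[OF tb] M_taylor2[OF tb(1), of a] assms by linarith
qed

text \<open>Equivalent to \<open>M s / s ^ 3\<close> being nondecreasing. It follows by integrating twice from
  \<open>D2 s \<le> s * D3 s\<close>, which holds because \<open>D3\<close> is nondecreasing and \<open>D2 0 = 0\<close>.\<close>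

lemma M_cubic_derivative:
  assumes "0 \<le> s"
  shows "3 * M s \<le> s * D1 s"
proof -
  have 1: "D2 s \<le> s * D3 s" if s: "s \<ge> 0" for s
  proof (rule le_of_derivative_le[where f = D2 and f' = D3 and g = "\<lambda>\<sigma>. \<sigma> * D3 s" and g' = "\<lambda>_. D3 s" and x = 0])
    fix \<sigma> assume \<sigma>: "\<sigma> \<in> {0..s}"
    show "((\<lambda>\<sigma>. \<sigma> * D3 s) has_real_derivative D3 s) (at \<sigma> within {0..s})"
      by (rule derivative_eq_intros refl | simp)+
  qed (use s D2_0 in \<open>auto intro!: D_within mono_onD[OF mono_D3]\<close>)
  have 2: "2 * D1 s \<le> s * D2 s" if s: "s \<ge> 0" for s
  proof (rule le_of_derivative_le[where f = "\<lambda>s. 2 * D1 s" and f' = "\<lambda>s. 2 * D2 s"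
        and g = "\<lambda>s. s * D2 s" and g' = "\<lambda>s. D2 s + s * D3 s" and x = 0])
    fix \<sigma> assume \<sigma>: "\<sigma> \<in> {0..s}"
    show "((\<lambda>\<sigma>. \<sigma> * D2 \<sigma>) has_real_derivative D2 \<sigma> + \<sigma> * D3 \<sigma>) (at \<sigma> within {0..s})"
      using \<sigma> by (auto intro!: derivative_eq_intros D_within)
    show "((\<lambda>\<sigma>. 2 * D1 \<sigma>) has_real_derivative 2 * D2 \<sigma>) (at \<sigma> within {0..s})"
      using \<sigma> by (auto intro!: DERIV_cmult D_within)
  qed (use s D1_0 1 in auto)
  show ?thesis
  proof (rule le_of_derivative_le[where f = "\<lambda>s. 3 * M s" and f' = "\<lambda>s. 3 * D1 s"
        and g = "\<lambda>s. s * D1 s" and g' = "\<lambda>s. D1 s + s * D2 s" and x = 0])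
    fix \<sigma> assume \<sigma>: "\<sigma> \<in> {0..s}"
    show "((\<lambda>\<sigma>. \<sigma> * D1 \<sigma>) has_real_derivative D1 \<sigma> + \<sigma> * D2 \<sigma>) (at \<sigma> within {0..s})"
      using \<sigma> by (auto intro!: derivative_eq_intros D_within)
    show "((\<lambda>\<sigma>. 3 * M \<sigma>) has_real_derivative 3 * D1 \<sigma>) (at \<sigma> within {0..s})"
      using \<sigma> by (auto intro!: DERIV_cmult D_within)
  qed (use assms M_0 2 in auto)
qed

lemma D1_interior: "0 < s \<Longrightarrow> (M has_real_derivative D1 s) (at s)"
  using D1[of s] at_within_interior[of s "{0..}"] by simp

lemma cubic_scale:
  assumes "0 \<le> t" "t \<le> 1" "0 \<le> s"
  shows "M (t * s) \<le> t ^ 3 * M s"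
proof (cases "t * s = 0")
  case True
  then show ?thesis using assms M_0 M_nonneg[of s] by auto
next
  case False
  then have pos: "0 < t" "0 < s" "0 < t * s" using assms by (auto simp: zero_less_mult_iff)
  have le: "t * s \<le> s" using assms pos by (simp add: mult_left_le_one_le)
  have "M (t * s) / (t * s) ^ 3 \<le> M s / s ^ 3"
  proof (rule DERIV_nonneg_imp_nondecreasing[OF le])
    fix x assume "t * s \<le> x" "x \<le> s"
    then have x: "0 < x" using pos by linarith
    have "((\<lambda>x. M x / x ^ 3) has_real_derivative (D1 x * x ^ 3 - M x * (3 * x\<^sup>2)) / (x ^ 3 * x ^ 3)) (at x)"
      using x by (auto intro!: derivative_eq_intros D1_interior)
    moreover have "D1 x * x ^ 3 - M x * (3 * x\<^sup>2) = x\<^sup>2 * (x * D1 x - 3 * M x)"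
      by (simp add: power2_eq_square power3_eq_cube algebra_simps)
    moreover have "\<dots> \<ge> 0" using M_cubic_derivative[of x] x by (intro mult_nonneg_nonneg) auto
    ultimately show "\<exists>y. ((\<lambda>x. M x / x ^ 3) has_real_derivative y) (at x) \<and> 0 \<le> y"
      using x by (metis divide_nonneg_pos zero_less_power mult_pos_pos)
  qed
  then show ?thesis using pos by (simp add: power_mult_distrib field_simps)
qed

text \<open>Near 0 the condition bounds \<open>s * D1 s / M s\<close> by some \<open>n\<close>, so \<open>M s / s ^ n\<close> is
  nonincreasing there and dilation by \<open>L\<close> costs at most \<open>L ^ n\<close>. Away from 0, \<open>M\<close> is bounded below by
  a positive constant and the bound is trivial on a bounded interval.\<close>

lemma dilation_bound:
  assumes "Limsup (at_right 0) (\<lambda>t. ereal (t * D1 t / M t)) < \<infinity>"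
    and "\<forall>\<^sub>F t in at_right 0. M t \<noteq> 0" and "L \<ge> 1"
  shows "\<exists>K\<ge>1. \<forall>s\<in>{0..S}. M (L * s) \<le> K * M s"
proof -
  obtain n :: nat where n: "Limsup (at_right 0) (\<lambda>t. ereal (t * D1 t / M t)) < ereal n"
    using assms(1) less_PInf_Ex_of_nat[THEN iffD1] by (metis less_irrefl)
  have "\<forall>\<^sub>F t in at_right 0. ereal (t * D1 t / M t) < ereal n \<and> M t \<noteq> 0"
    using Limsup_lessD[OF n] assms(2) by (rule eventually_conj)
  then obtain b where b: "b > 0" "\<And>t. 0 < t \<Longrightarrow> t < b \<Longrightarrow> t * D1 t / M t < real n \<and> M t \<noteq> 0"
    by (auto simp: eventually_at_right_field)
  have pos: "M t > 0" if "0 < t" for t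
  proof -
    have "0 < M (min t (b / 2))"
      using b(2)[of "min t (b / 2)"] M_nonneg[of "min t (b / 2)"] that \<open>b > 0\<close> by (auto simp: min_def)
    also have "\<dots> \<le> M t" using that \<open>b > 0\<close> by (intro orlicz_mono[OF orlicz]) auto
    finally show ?thesis .
  qed
  have slope: "t * D1 t \<le> n * M t" if "0 < t" "t < b" for t
    using b(2)[OF that] pos[OF that(1)] by (simp add: divide_less_eq)
  have small_s: "M (L * s) \<le> L ^ n * M s" if s: "0 < s" "L * s < b" for s
  proof -
    have le: "s \<le> L * s" using s assms by simp
    have "M s / s ^ n \<ge> M (L * s) / (L * s) ^ n"
    proof (rule DERIV_nonpos_imp_nonincreasing[OF le])
      fix x assume "s \<le> x" "x \<le> L * s"
      then have x: "0 < x" "x < b" using s by linarith+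
      have "((\<lambda>x. M x / x ^ n) has_real_derivative
              (D1 x * x ^ n - M x * (n * x ^ (n - 1))) / (x ^ n * x ^ n)) (at x)"
        using x by (auto intro!: derivative_eq_intros D1_interior)
      moreover have "D1 x * x ^ n - M x * (n * x ^ (n - 1)) \<le> 0"
      proof -
        have "x * (D1 x * x ^ n - M x * (n * x ^ (n - 1))) = x ^ n * (x * D1 x - n * M x)"
          by (cases n) (auto simp: algebra_simps)
        also have "\<dots> \<le> 0" using slope[OF x] x by (intro mult_nonneg_nonpos) auto
        finally show ?thesis using x by (simp add: mult_le_0_iff)
      qed
      ultimately show "\<exists>y. ((\<lambda>x. M x / x ^ n) has_real_derivative y) (at x) \<and> y \<le> 0"
        using x by (metis divide_nonpos_pos zero_less_power mult_pos_pos)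
    qed
    then show ?thesis using s assms by (simp add: power_mult_distrib field_simps)
  qed
  \<comment> \<open>The factor 2 keeps \<open>L * s0\<close> strictly inside the interval \<open>(0,b)\<close> of the local estimate.\<close>
  define s0 where "s0 = b / (2 * L)"
  have s0: "s0 > 0" "L * s0 < b" using b(1) assms by (auto simp: s0_def field_simps)
  define K where "K = max (L ^ n) (M (L * S) / M s0)"
  have "M (L * s) \<le> K * M s" if s: "s \<in> {0..S}" for s
  proof (cases "s = 0")
    case False
    then have s_pos: "0 < s" using s by auto
    show ?thesis
    proof (cases "s \<le> s0")
      case True
      then have "L * s < b" using s0 assms mult_left_mono[of s s0 L] by linarith
      then have "M (L * s) \<le> L ^ n * M s" using s_pos small_s by auto
      also have "\<dots> \<le> K * M s" using pos[OF s_pos] by (intro mult_right_mono) (auto simp: K_def)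
      finally show ?thesis .
    next
      case False
      have "M (L * s) \<le> M (L * S)" using s assms by (intro orlicz_mono[OF orlicz]) auto
      also have "\<dots> = M (L * S) / M s0 * M s0" using pos[OF s0(1)] by simp
      also have "\<dots> \<le> K * M s"
        using pos[OF s0(1)] s0(1) False s assms
        by (intro mult_mono orlicz_mono[OF orlicz]) (auto simp: K_def M_nonneg le_max_iff_disj)
      finally show ?thesis .
    qed
  qed (simp add: M_0)
  moreover have "K \<ge> 1" using assms by (auto simp: K_def le_max_iff_disj)
  ultimately show ?thesis by blast
qed

section \<open>The modular of the overlap of two vectors\<close>

text \<open>Summed over coordinates, the modulars of \<open>(u + t v) / R\<close> and \<open>(u - t v) / R\<close> total at most 2.
  They exceed twice the modular of \<open>u / R\<close> by at least the left-hand side of the claim, so it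
  remains to see that the modular of \<open>u / R\<close> is almost 1. It is more than 1 after replacing \<open>R\<close> by
  the slightly smaller \<open>r\<close>, and doubling together with convexity limits what this replacement can
  contribute.\<close>

lemma overlap_estimate:
  fixes u v :: "'i \<Rightarrow> real"
  assumes t: "0 \<le> t" "t \<le> 1" and r: "0 < r" "r \<le> R" "R \<le> 2 * r"
    and plus: "\<And>F. finite F \<Longrightarrow> (\<Sum>k\<in>F. M (\<bar>u k + t * v k\<bar> / R)) \<le> 1"
    and minus: "\<And>F. finite F \<Longrightarrow> (\<Sum>k\<in>F. M (\<bar>u k - t * v k\<bar> / R)) \<le> 1"
    and A: "finite A" "(\<Sum>k\<in>A. M (\<bar>u k\<bar> / r)) > 1"
    and dbl: "\<And>s. 0 \<le> s \<Longrightarrow> M s \<le> 1 \<Longrightarrow> M (2 * s) \<le> K * M s" and K: "K \<ge> 0"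
    and F: "finite F"
  shows "t\<^sup>2 * (\<Sum>k\<in>{k\<in>F. \<bar>v k\<bar> \<le> \<bar>u k\<bar>}. M (\<bar>v k\<bar> / R)) \<le> 2 * (K * (R / r - 1))"
proof -
  have R: "R > 0" using r by linarith
  define a b where "a k = \<bar>u k\<bar> / R" and "b k = \<bar>v k\<bar> / R" for k
  define p m where "p k = \<bar>u k + t * v k\<bar> / R" and "m k = \<bar>u k - t * v k\<bar> / R" for k
  have nonneg: "0 \<le> a k" "0 \<le> b k" "0 \<le> p k" "0 \<le> m k" for k
    using R by (auto simp: a_def b_def p_def m_def)
  \<comment> \<open>Convexity alone makes every second difference nonnegative.\<close>
  have mid: "2 * M (a k) \<le> M (p k) + M (m k)" for k
  proof -
    have "\<bar>u k\<bar> \<le> (\<bar>u k + t * v k\<bar> + \<bar>u k - t * v k\<bar>) / 2" by (simp add: abs_if)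
    then have "a k \<le> (\<bar>u k + t * v k\<bar> + \<bar>u k - t * v k\<bar>) / 2 / R"
      unfolding a_def using R by (intro divide_right_mono) auto
    then have "M (a k) \<le> M ((1 - 1 / 2) *\<^sub>R p k + (1 / 2) *\<^sub>R m k)"
      using nonneg[of k] by (intro orlicz_mono[OF orlicz]) (auto simp: p_def m_def add_divide_distrib)
    also have "\<dots> \<le> (1 - 1 / 2) * M (p k) + 1 / 2 * M (m k)"
      using orlicz nonneg[of k] by (intro convex_onD[of "{0..}"]) (auto simp: orlicz_function_def)
    finally show ?thesis by simp
  qed
  have gap: "2 * M (a k) + t\<^sup>2 * M (b k) \<le> M (p k) + M (m k)" if "\<bar>v k\<bar> \<le> \<bar>u k\<bar>" for k
  proof -
    have "\<bar>t * v k\<bar> \<le> \<bar>u k\<bar>"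
      using t that mult_left_le_one_le[of "\<bar>v k\<bar>" t] by (simp add: abs_mult)
    then have "(\<bar>u k + t * v k\<bar> = \<bar>u k\<bar> + \<bar>t * v k\<bar> \<and> \<bar>u k - t * v k\<bar> = \<bar>u k\<bar> - \<bar>t * v k\<bar>) \<or>
      (\<bar>u k - t * v k\<bar> = \<bar>u k\<bar> + \<bar>t * v k\<bar> \<and> \<bar>u k + t * v k\<bar> = \<bar>u k\<bar> - \<bar>t * v k\<bar>)"
      by linarith
    then have "M (p k) + M (m k) = M (a k + t * b k) + M (a k - t * b k)"
      using t by (auto simp: p_def m_def a_def b_def abs_mult add_divide_distrib diff_divide_distrib)
    moreover have "b k \<le> a k" using that R by (simp add: a_def b_def divide_right_mono)
    ultimately show ?thesis using second_difference[of "b k" "a k" t] nonneg[of k] t by simp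
  qed
  have le1: "M (a k) \<le> 1" for k
    using mid[of k] plus[of "{k}"] minus[of "{k}"] by (simp add: p_def m_def)
  have stretch: "M (\<bar>u k\<bar> / r) \<le> (1 + K * (R / r - 1)) * M (a k)" for k
  proof -
    define q where "q = R / r"
    have q: "1 \<le> q" "q \<le> 2" using r R by (auto simp: q_def field_simps)
    \<comment> \<open>\<open>q * a k\<close> lies between \<open>a k\<close> and \<open>2 * a k\<close>, at the fraction \<open>q - 1\<close> of the way.\<close>
    have "M (\<bar>u k\<bar> / r) = M ((1 - (q - 1)) *\<^sub>R a k + (q - 1) *\<^sub>R (2 * a k))"
    proof (rule arg_cong[where f = M])
      have "(1 - (q - 1)) *\<^sub>R a k + (q - 1) *\<^sub>R (2 * a k) = q * a k" by (simp add: algebra_simps)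
      then show "\<bar>u k\<bar> / r = (1 - (q - 1)) *\<^sub>R a k + (q - 1) *\<^sub>R (2 * a k)"
        using R by (simp add: q_def a_def)
    qed
    also have "\<dots> \<le> (1 - (q - 1)) * M (a k) + (q - 1) * M (2 * a k)"
      using orlicz nonneg[of k] q by (intro convex_onD[of "{0..}"]) (auto simp: orlicz_function_def)
    also have "\<dots> \<le> 1 * M (a k) + (q - 1) * (K * M (a k))"
      using q nonneg[of k] M_nonneg le1 by (intro add_mono mult_right_mono mult_left_mono dbl) auto
    finally show ?thesis by (simp add: q_def algebra_simps)
  qed
  define B where "B = F \<union> A"
  define S where "S = (\<Sum>k\<in>B. M (a k))"
  define G where "G = {k\<in>F. \<bar>v k\<bar> \<le> \<bar>u k\<bar>}"
  define \<kappa> where "\<kappa> = K * (R / r - 1)"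
  have fin: "finite B" "finite G" and sub: "G \<subseteq> B" using F A by (auto simp: B_def G_def)
  have \<kappa>: "\<kappa> \<ge> 0" using K r by (auto simp: \<kappa>_def)
  have pm: "(\<Sum>k\<in>B. M (p k) + M (m k)) \<le> 2"
    using plus[OF fin(1)] minus[OF fin(1)] by (simp add: sum.distrib p_def m_def)
  have "2 * S + t\<^sup>2 * (\<Sum>k\<in>G. M (b k)) = (\<Sum>k\<in>B. 2 * M (a k) + (if k \<in> G then t\<^sup>2 * M (b k) else 0))"
    using fin sub by (simp add: S_def sum.distrib sum_distrib_left sum.If_cases Int_absorb1)
  also have "\<dots> \<le> (\<Sum>k\<in>B. M (p k) + M (m k))"
    using gap mid by (intro sum_mono) (auto simp: G_def)
  finally have upper: "2 * S + t\<^sup>2 * (\<Sum>k\<in>G. M (b k)) \<le> 2" using pm by linarith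
  have "0 \<le> t\<^sup>2 * (\<Sum>k\<in>G. M (b k))"
    using nonneg M_nonneg by (intro mult_nonneg_nonneg sum_nonneg) auto
  with upper have "S \<le> 1" by linarith
  have "1 < (\<Sum>k\<in>A. (1 + \<kappa>) * M (a k))"
    using A(2) sum_mono[of A "\<lambda>k. M (\<bar>u k\<bar> / r)" "\<lambda>k. (1 + \<kappa>) * M (a k)"] stretch
    by (simp add: \<kappa>_def)
  also have "\<dots> \<le> (\<Sum>k\<in>B. (1 + \<kappa>) * M (a k))"
    using fin nonneg M_nonneg \<kappa> by (intro sum_mono2) (auto simp: B_def)
  also have "\<dots> = S + \<kappa> * S" by (simp add: S_def distrib_right sum.distrib sum_distrib_left)
  also have "\<dots> \<le> S + \<kappa> * 1" using \<open>S \<le> 1\<close> \<kappa> by (intro add_left_mono mult_left_mono)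
  finally have "1 < S + \<kappa>" by simp
  with upper show ?thesis by (simp add: G_def b_def \<kappa>_def)
qed

end

section \<open>The Luxemburg norm through finite sums\<close>

lemma modular_le_1_iff:
  assumes "orlicz_function M" "\<rho> > 0"
  shows "(\<Sum>\<^sub>\<infinity>k\<in>I. ennreal (M (\<bar>x k\<bar> / \<rho>))) \<le> 1 \<longleftrightarrow>
    (\<forall>F. finite F \<and> F \<subseteq> I \<longrightarrow> (\<Sum>k\<in>F. M (\<bar>x k\<bar> / \<rho>)) \<le> 1)"
proof -
  have "(\<Sum>k\<in>F. ennreal (M (\<bar>x k\<bar> / \<rho>))) = ennreal (\<Sum>k\<in>F. M (\<bar>x k\<bar> / \<rho>))" for F
    using assms by (intro sum_ennreal) (auto simp: orlicz_nonneg)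
  then show ?thesis
    by (subst nonneg_infsum_complete) (auto simp: SUP_le_iff)
qed

text \<open>The infimum in the Luxemburg norm is attained when it is positive and finite, as \<open>M\<close> is
  continuous on \<open>(0,\<infinity>)\<close>. This is what allows all
  estimates below to be carried out with finite sums of reals.\<close>

lemma lux_norm_le_iff:
  assumes M: "orlicz_function M" and "r > 0"
  shows "lux_norm M I x \<le> ennreal r \<longleftrightarrow>
    (\<forall>F. finite F \<and> F \<subseteq> I \<longrightarrow> (\<Sum>k\<in>F. M (\<bar>x k\<bar> / r)) \<le> 1)" (is "_ \<longleftrightarrow> ?R")
proof
  assume ?R
  then show "lux_norm M I x \<le> ennreal r"
    unfolding lux_norm_def using modular_le_1_iff[OF assms] assms by (intro Inf_lower) auto
next
  assume le: "lux_norm M I x \<le> ennreal r"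
  have above: "(\<Sum>k\<in>F. M (\<bar>x k\<bar> / \<rho>)) \<le> 1" if "\<rho> > r" "finite F" "F \<subseteq> I" for \<rho> F
  proof -
    have "lux_norm M I x < ennreal \<rho>"
      using le that \<open>r > 0\<close> by (metis ennreal_lessI less_trans order_le_less_trans)
    then obtain \<sigma> where \<sigma>: "\<sigma> > 0" "\<sigma> < \<rho>" "(\<Sum>\<^sub>\<infinity>k\<in>I. ennreal (M (\<bar>x k\<bar> / \<sigma>))) \<le> 1"
      unfolding lux_norm_def Inf_less_iff using that \<open>r > 0\<close> by (auto simp: ennreal_less_iff)
    have "(\<Sum>k\<in>F. M (\<bar>x k\<bar> / \<rho>)) \<le> (\<Sum>k\<in>F. M (\<bar>x k\<bar> / \<sigma>))"
      using \<sigma> by (intro sum_mono orlicz_mono[OF M]) (auto intro!: divide_left_mono)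
    also have "\<dots> \<le> 1" using modular_le_1_iff[OF M \<sigma>(1)] \<sigma>(3) that by blast
    finally show ?thesis .
  qed
  have cont: "continuous_on {0<..} M"
    using M by (intro convex_on_continuous) (auto simp: orlicz_function_def intro: convex_on_subset)
  show ?R
  proof (intro allI impI)
    fix F assume F: "finite F \<and> F \<subseteq> I"
    have "((\<lambda>\<rho>. \<Sum>k\<in>F. M (\<bar>x k\<bar> / \<rho>)) \<longlongrightarrow> (\<Sum>k\<in>F. M (\<bar>x k\<bar> / r))) (at_right r)"
    proof (intro tendsto_sum)
      fix k
      show "((\<lambda>\<rho>. M (\<bar>x k\<bar> / \<rho>)) \<longlongrightarrow> M (\<bar>x k\<bar> / r)) (at_right r)"
      proof (cases "x k = 0")
        case False
        then have "isCont M (\<bar>x k\<bar> / r)"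
          using cont \<open>r > 0\<close> by (auto simp: continuous_on_eq_continuous_at)
        then show ?thesis
          by (rule isCont_tendsto_compose) (use \<open>r > 0\<close> in \<open>auto intro!: tendsto_intros\<close>)
      qed auto
    qed
    moreover have "\<forall>\<^sub>F \<rho> in at_right r. (\<Sum>k\<in>F. M (\<bar>x k\<bar> / \<rho>)) \<le> 1"
      using above F by (auto simp: eventually_at_right_field intro: exI[of _ "r + 1"])
    ultimately show "(\<Sum>k\<in>F. M (\<bar>x k\<bar> / r)) \<le> 1"
      by (rule tendsto_upperbound) simp
  qed
qed

lemma orlicz_space_iff:
  "x \<in> orlicz_space M I \<longleftrightarrow> (\<forall>k. k \<notin> I \<longrightarrow> x k = 0) \<and> (\<exists>r>0. lux_norm M I x \<le> ennreal r)"
proof -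
  have "lux_norm M I x < \<infinity> \<longleftrightarrow> (\<exists>r>0. lux_norm M I x \<le> ennreal r)"
  proof
    assume "lux_norm M I x < \<infinity>"
    then obtain r where "r \<ge> 0" "lux_norm M I x = ennreal r"
      by (cases "lux_norm M I x") auto
    then show "\<exists>r>0. lux_norm M I x \<le> ennreal r"
      by (intro exI[of _ "r + 1"]) (auto intro: ennreal_leI)
  qed (auto intro: le_less_trans)
  then show ?thesis by (simp add: orlicz_space_def)
qed

lemma lux_norm_scale_le:
  assumes "orlicz_function M" "lux_norm M I x \<le> ennreal r" "r > 0" "c > 0"
  shows "lux_norm M I (\<lambda>k. c * x k) \<le> ennreal (c * r)"
  using assms by (subst lux_norm_le_iff) (auto simp: lux_norm_le_iff abs_mult)

lemma lux_norm_mono_le: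
  assumes M: "orlicz_function M" and x: "lux_norm M I x \<le> ennreal r" "r > 0"
    and le: "\<And>k. \<bar>y k\<bar> \<le> \<bar>x k\<bar>"
  shows "lux_norm M I y \<le> ennreal r"
proof (subst lux_norm_le_iff[OF M \<open>r > 0\<close>], intro allI impI)
  fix F assume F: "finite F \<and> F \<subseteq> I"
  have "(\<Sum>k\<in>F. M (\<bar>y k\<bar> / r)) \<le> (\<Sum>k\<in>F. M (\<bar>x k\<bar> / r))"
    using le \<open>r > 0\<close> by (intro sum_mono orlicz_mono[OF M]) (auto intro: divide_right_mono)
  also have "\<dots> \<le> 1" using x F lux_norm_le_iff[OF M \<open>r > 0\<close>] by blast
  finally show "(\<Sum>k\<in>F. M (\<bar>y k\<bar> / r)) \<le> 1" .
qed

lemma orlicz_space_scale: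
  assumes "orlicz_function M" "x \<in> orlicz_space M I" "c > 0"
  shows "(\<lambda>k. c * x k) \<in> orlicz_space M I"
proof -
  obtain r where "r > 0" "lux_norm M I x \<le> ennreal r" using assms(2) by (auto simp: orlicz_space_iff)
  then have "c * r > 0" "lux_norm M I (\<lambda>k. c * x k) \<le> ennreal (c * r)"
    using assms(3) by (auto intro: lux_norm_scale_le[OF assms(1)])
  then show ?thesis using assms(2) unfolding orlicz_space_iff by auto
qed

lemma orlicz_space_mono:
  assumes "orlicz_function M" "x \<in> orlicz_space M UNIV" "\<And>k. \<bar>y k\<bar> \<le> \<bar>x k\<bar>"
  shows "y \<in> orlicz_space M UNIV"
proof -
  obtain r where r: "r > 0" "lux_norm M UNIV x \<le> ennreal r" using assms(2) by (auto simp: orlicz_space_iff)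
  then have "lux_norm M UNIV y \<le> ennreal r" by (intro lux_norm_mono_le[OF assms(1) r(2,1) assms(3)])
  then show ?thesis using r(1) by (auto simp: orlicz_space_iff)
qed

lemma normalise:
  assumes M: "orlicz_function M" and f: "f \<in> orlicz_space M I"
    and le1: "lux_norm M I f \<le> 1" and nz: "lux_norm M I f \<noteq> 0"
  obtains p f0 where "0 < p" "p \<le> 1" "f = (\<lambda>k. p * f0 k)" "f0 \<in> orlicz_space M I"
    "lux_norm M I f0 \<le> 1" "\<And>r. 0 < r \<Longrightarrow> r < 1 \<Longrightarrow> \<not> lux_norm M I f0 \<le> ennreal r"
proof -
  obtain p where p: "lux_norm M I f = ennreal p" "p \<ge> 0"
    using f by (cases "lux_norm M I f") (auto simp: orlicz_space_def)
  then have p01: "0 < p" "p \<le> 1" using nz le1 by (auto simp: ennreal_eq_0_iff less_le)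
  define f0 where "f0 = (\<lambda>k. (1 / p) * f k)"
  have f_eq: "f = (\<lambda>k. p * f0 k)" using p01 by (auto simp: f0_def)
  show thesis
  proof (rule that[OF p01 f_eq])
    show "f0 \<in> orlicz_space M I" unfolding f0_def using p01 by (intro orlicz_space_scale[OF M f]) auto
    show "lux_norm M I f0 \<le> 1"
      using lux_norm_scale_le[OF M, of I f p "1 / p"] p p01 by (simp add: f0_def)
    fix r :: real assume r: "0 < r" "r < 1"
    show "\<not> lux_norm M I f0 \<le> ennreal r"
    proof
      assume "lux_norm M I f0 \<le> ennreal r"
      then have "lux_norm M I f \<le> ennreal (p * r)"
        using lux_norm_scale_le[OF M _ r(1) p01(1), of I f0] f_eq by simp
      then show False using p p01 r by simp
    qed
  qed
qed

section \<open>Almost isometric embeddings\<close>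

text \<open>The bounds on the two operator norms, which speak of unit balls only, extended to all radii by
  homogeneity.\<close>

lemma Emb_norm_le:
  assumes M: "orlicz_function M1" "orlicz_function M2" and "C > 0"
    and T: "T \<in> Emb C (orlicz_space M1 I) (lux_norm M1 I) (orlicz_space M2 J) (lux_norm M2 J)"
    and x: "x \<in> orlicz_space M1 I" and "r > 0"
  shows "lux_norm M1 I x \<le> ennreal r \<Longrightarrow> lux_norm M2 J (T x) \<le> ennreal (C * r)"
    and "lux_norm M2 J (T x) \<le> ennreal r \<Longrightarrow> lux_norm M1 I x \<le> ennreal (C * r)"
proof -
  let ?X = "orlicz_space M1 I" and ?y = "\<lambda>k. (1 / r) * x k"
  have y: "?y \<in> ?X" using \<open>r > 0\<close> by (intro orlicz_space_scale[OF M(1) x]) auto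
  have x_eq: "(\<lambda>k. r * ?y k) = x" and Tx_eq: "(\<lambda>j. r * ((1 / r) * T x j)) = T x"
    using \<open>r > 0\<close> by auto
  have Ty: "T ?y = (\<lambda>j. (1 / r) * T x j)"
    using T x unfolding Emb_def linear_map_on_def by blast
  have bound: "op_norm ?X (lux_norm M1 I) (lux_norm M2 J) T \<le> ennreal C"
    "op_norm (T ` ?X) (lux_norm M2 J) (lux_norm M1 I) (inv_into ?X T) \<le> ennreal C"
    and inj: "inj_on T ?X"
    using T by (auto simp: Emb_def)
  show "lux_norm M2 J (T x) \<le> ennreal (C * r)" if "lux_norm M1 I x \<le> ennreal r"
  proof -
    have "lux_norm M1 I ?y \<le> 1" using lux_norm_scale_le[OF M(1) that, of "1 / r"] \<open>r > 0\<close> by simp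
    then have "lux_norm M2 J (T ?y) \<le> ennreal C"
      using bound(1) y unfolding op_norm_def SUP_le_iff by blast
    from lux_norm_scale_le[OF M(2) this \<open>C > 0\<close> \<open>r > 0\<close>] show ?thesis
      unfolding Ty Tx_eq by (simp add: mult.commute)
  qed
  show "lux_norm M1 I x \<le> ennreal (C * r)" if "lux_norm M2 J (T x) \<le> ennreal r"
  proof -
    have "lux_norm M2 J (T ?y) \<le> 1"
      using lux_norm_scale_le[OF M(2) that, of "1 / r"] \<open>r > 0\<close> unfolding Ty by simp
    then have "lux_norm M1 I (inv_into ?X T (T ?y)) \<le> ennreal C"
      using bound(2) y unfolding op_norm_def SUP_le_iff by blast
    then have "lux_norm M1 I ?y \<le> ennreal C" using inv_into_f_f[OF inj y] by simp
    from lux_norm_scale_le[OF M(1) this \<open>C > 0\<close> \<open>r > 0\<close>] show ?thesis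
      unfolding x_eq by (simp add: mult.commute)
  qed
qed

text \<open>The properties used of the images of a disjoint pair of norm one vectors under an embedding
  with constant \<open>1 + t ^ 3\<close>. One factor \<open>1 + t ^ 3\<close> of the upper bound comes from disjointness and the other
  from the embedding. The images have norm at least \<open>1 / (1 + t ^ 3)\<close>; the square in the lower bounds
  turns this into a strict inequality.\<close>

definition cubic_pair :: "(real \<Rightarrow> real) \<Rightarrow> real \<Rightarrow> ('i \<Rightarrow> real) \<Rightarrow> ('i \<Rightarrow> real) \<Rightarrow> bool" where
  "cubic_pair M t u v \<longleftrightarrow>
    (\<forall>\<sigma>. \<bar>\<sigma>\<bar> = t \<longrightarrow> lux_norm M UNIV (\<lambda>k. u k + \<sigma> * v k) \<le> ennreal ((1 + t ^ 3)\<^sup>2) \<and>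
                  lux_norm M UNIV (\<lambda>k. v k + \<sigma> * u k) \<le> ennreal ((1 + t ^ 3)\<^sup>2)) \<and>
    \<not> lux_norm M UNIV u \<le> ennreal (1 / (1 + t ^ 3)\<^sup>2) \<and>
    \<not> lux_norm M UNIV v \<le> ennreal (1 / (1 + t ^ 3)\<^sup>2)"

context cubic_orlicz
begin

text \<open>On disjoint supports the modular is additive. That of \<open>t g\<close> is at most \<open>t ^ 3\<close> by the cubic
  estimate, and division by \<open>1 + \<bar>t\<bar> ^ 3\<close> reduces the total to 1 by convexity.\<close>

lemma lux_norm_disjoint_sum:
  assumes f: "lux_norm M I f \<le> 1" and g: "lux_norm M I g \<le> 1" and dis: "disjoint_vec f g"
    and t: "\<bar>t\<bar> \<le> 1"
  shows "lux_norm M I (\<lambda>k. f k + t * g k) \<le> ennreal (1 + \<bar>t\<bar> ^ 3)"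
proof -
  define \<rho> where "\<rho> = 1 + \<bar>t\<bar> ^ 3"
  have \<rho>: "\<rho> \<ge> 1" "\<rho> > 0" by (auto simp: \<rho>_def add_pos_nonneg)
  have shrink: "M (s / \<rho>) \<le> M s / \<rho>" if "s \<ge> 0" for s
    using orlicz_scale_le[OF orlicz, of "1 / \<rho>" s] that \<rho> by simp
  have termwise: "M (\<bar>f k + t * g k\<bar> / \<rho>) \<le> (M \<bar>f k\<bar> + \<bar>t\<bar> ^ 3 * M \<bar>g k\<bar>) / \<rho>" for k
  proof (cases "f k = 0")
    case True
    have "M (\<bar>f k + t * g k\<bar> / \<rho>) \<le> M (\<bar>t\<bar> * \<bar>g k\<bar>) / \<rho>"
      using shrink[of "\<bar>t\<bar> * \<bar>g k\<bar>"] True by (simp add: abs_mult)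
    also have "\<dots> \<le> \<bar>t\<bar> ^ 3 * M \<bar>g k\<bar> / \<rho>"
      using \<rho> t by (intro divide_right_mono cubic_scale) auto
    finally show ?thesis using True M_0 by simp
  next
    case False
    then have "g k = 0" using dis by (auto simp: disjoint_vec_def support_def)
    then show ?thesis using shrink[of "\<bar>f k\<bar>"] M_0 by simp
  qed
  have "lux_norm M I (\<lambda>k. f k + t * g k) \<le> ennreal \<rho>"
  proof (subst lux_norm_le_iff[OF orlicz \<open>\<rho> > 0\<close>], intro allI impI)
    fix F assume F: "finite F \<and> F \<subseteq> I"
    have "(\<Sum>k\<in>F. M (\<bar>f k + t * g k\<bar> / \<rho>)) \<le> (\<Sum>k\<in>F. (M \<bar>f k\<bar> + \<bar>t\<bar> ^ 3 * M \<bar>g k\<bar>) / \<rho>)"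
      by (intro sum_mono termwise)
    also have "\<dots> = ((\<Sum>k\<in>F. M \<bar>f k\<bar>) + \<bar>t\<bar> ^ 3 * (\<Sum>k\<in>F. M \<bar>g k\<bar>)) / \<rho>"
      by (simp add: sum_divide_distrib[symmetric] sum.distrib sum_distrib_left)
    also have "\<dots> \<le> (1 + \<bar>t\<bar> ^ 3 * 1) / \<rho>"
      using f g F lux_norm_le_iff[OF orlicz, of 1 I f] lux_norm_le_iff[OF orlicz, of 1 I g] \<rho>
      by (intro divide_right_mono add_mono mult_left_mono) auto
    also have "\<dots> = 1" using \<rho> by (simp add: \<rho>_def)
    finally show "(\<Sum>k\<in>F. M (\<bar>f k + t * g k\<bar> / \<rho>)) \<le> 1" .
  qed
  then show ?thesis by (simp add: \<rho>_def)
qed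

text \<open>The approximants keep, at each coordinate, the larger of the two entries, and so differ from
  \<open>u\<close> and \<open>v\<close> by at most \<open>w = min \<bar>u\<bar> \<bar>v\<bar>\<close>. The overlap estimate, applied in both orders, bounds the
  modular of \<open>w / R\<close> by a multiple of \<open>t\<close>, and the dilation bound passes from \<open>w / R\<close> to \<open>w / \<epsilon>\<close>.\<close>

lemma almost_disjoint_images:
  assumes dil: "\<And>L S. L \<ge> 1 \<Longrightarrow> \<exists>K\<ge>1. \<forall>s\<in>{0..S}. M (L * s) \<le> K * M s" and "\<epsilon> > 0"
  shows "\<exists>t>0. t \<le> 1 \<and> (\<forall>u\<in>orlicz_space M (UNIV :: 'i set). \<forall>v\<in>orlicz_space M UNIV. cubic_pair M t u v \<longrightarrow>
    (\<exists>u'\<in>orlicz_space M UNIV. \<exists>v'\<in>orlicz_space M UNIV. disjoint_vec u' v' \<and>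
      lux_norm M UNIV (\<lambda>k. u k - u' k) \<le> ennreal \<epsilon> \<and>
      lux_norm M UNIV (\<lambda>k. v k - v' k) \<le> ennreal \<epsilon>))"
proof -
  have "\<forall>\<^sub>F s in at_top. M s \<ge> 2"
    using orlicz unfolding orlicz_function_def filterlim_at_top by blast
  then obtain S where S: "\<And>s. s \<ge> S \<Longrightarrow> M s \<ge> 2"
    unfolding eventually_at_top_linorder by blast
  have bdd: "s \<in> {0..S}" if "0 \<le> s" "M s \<le> 1" for s
    using S[of s] that by force
  obtain K where K: "K \<ge> 1" "\<And>s. s \<in> {0..S} \<Longrightarrow> M (2 * s) \<le> K * M s"
    using dil[of 2 S] by auto
  \<comment> \<open>As \<open>R \<le> 4\<close> below, dilation of \<open>w / R\<close> by \<open>L\<close> dominates \<open>w / \<epsilon>\<close>.\<close>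
  define L where "L = max 1 (4 / \<epsilon>)"
  obtain K' where K': "K' \<ge> 1" "\<And>s. s \<in> {0..S} \<Longrightarrow> M (L * s) \<le> K' * M s"
    using dil[of L S] by (auto simp: L_def)
  \<comment> \<open>\<open>60 * K * t\<close> is the bound for the modular of \<open>w / R\<close> obtained below, and \<open>K'\<close> the price of the
     dilation by \<open>L\<close>; \<open>t \<le> 1 / 3\<close> ensures \<open>15 * t ^ 3 \<le> 1\<close>, hence \<open>R / r \<le> 2\<close>.\<close>
  define t where "t = min (1 / 3) (1 / (60 * K * K'))"
  have t: "0 < t" "t \<le> 1 / 3" "t \<le> 1" and t_le: "60 * K * t * K' \<le> 1"
  proof -
    show "0 < t" "t \<le> 1 / 3" "t \<le> 1" using K K' by (auto simp: t_def)
    have "t \<le> 1 / (60 * K * K')" by (simp add: t_def)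
    then show "60 * K * t * K' \<le> 1" using K K' by (simp add: field_simps)
  qed
  define R r where "R = (1 + t ^ 3)\<^sup>2" and "r = 1 / (1 + t ^ 3)\<^sup>2"
  have t3: "0 < t ^ 3" "t ^ 3 \<le> 1 / 27"
    using t power_mono[of t "1 / 3" 3] by (auto simp: power_divide)
  have R: "R \<ge> 1" "R \<le> 4"
    using t3 power_mono[of "1 + t ^ 3" 2 2] by (auto simp: R_def one_le_power)
  have r: "0 < r" "r \<le> 1" using R by (simp_all add: r_def R_def[symmetric])
  have q: "R / r - 1 \<le> 15 * t ^ 3"
  proof -
    define y where "y = t ^ 3"
    have y: "0 \<le> y" "y \<le> 1" using t3 by (auto simp: y_def)
    have "y ^ n \<le> y" if "n \<ge> 1" for n using power_decreasing[of 1 n y] that y by simp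
    from this[of 2] this[of 3] this[of 4] have "(1 + y) ^ 4 \<le> 1 + 15 * y"
      by (simp add: eval_nat_numeral algebra_simps)
    moreover have "R / r = (1 + y) ^ 4"
      using y by (simp add: R_def r_def y_def power_add[symmetric])
    ultimately show ?thesis by (simp add: y_def)
  qed
  have half: "t\<^sup>2 * (\<Sum>k\<in>{k\<in>F. \<bar>v k\<bar> \<le> \<bar>u k\<bar>}. M (\<bar>v k\<bar> / R)) \<le> t\<^sup>2 * (30 * K * t)"
    if hyp: "\<And>\<sigma>. \<bar>\<sigma>\<bar> = t \<Longrightarrow> lux_norm M UNIV (\<lambda>k. u k + \<sigma> * v k) \<le> ennreal R"
      "\<not> lux_norm M UNIV u \<le> ennreal r" and F: "finite F" for u v :: "'i \<Rightarrow> real" and F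
  proof -
    have "R > 0" using R by simp
    obtain A where A: "finite A" "(\<Sum>k\<in>A. M (\<bar>u k\<bar> / r)) > 1"
      using hyp(2) lux_norm_le_iff[OF orlicz r(1), of UNIV u] by force
    have "t\<^sup>2 * (\<Sum>k\<in>{k\<in>F. \<bar>v k\<bar> \<le> \<bar>u k\<bar>}. M (\<bar>v k\<bar> / R)) \<le> 2 * (K * (R / r - 1))"
    proof (rule overlap_estimate[OF _ _ r(1) _ _ _ _ A _ _ F])
      have "15 * t ^ 3 \<le> 1" using t3 by simp
      then have "R / r \<le> 2" using q by linarith
      then show "R \<le> 2 * r" using r by (simp add: divide_le_eq)
      fix F :: "'i set" assume "finite F"
      then show "(\<Sum>k\<in>F. M (\<bar>u k + t * v k\<bar> / R)) \<le> 1" "(\<Sum>k\<in>F. M (\<bar>u k - t * v k\<bar> / R)) \<le> 1"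
        using hyp(1)[of t] hyp(1)[of "- t"] t
          lux_norm_le_iff[OF orlicz \<open>R > 0\<close>, of UNIV "\<lambda>k. u k + t * v k"]
          lux_norm_le_iff[OF orlicz \<open>R > 0\<close>, of UNIV "\<lambda>k. u k - t * v k"] by auto
    qed (use t K r R bdd in auto)
    also have "\<dots> \<le> 2 * (K * (15 * t ^ 3))" using q K by (intro mult_left_mono) auto
    also have "\<dots> = t\<^sup>2 * (30 * K * t)" by (simp add: power2_eq_square power3_eq_cube)
    finally show ?thesis .
  qed
  show ?thesis
  proof (intro exI[of _ t] conjI ballI impI)
    fix u v :: "'i \<Rightarrow> real"
    assume u: "u \<in> orlicz_space M UNIV" and v: "v \<in> orlicz_space M UNIV" and "cubic_pair M t u v"
    then have uv: "\<And>\<sigma>. \<bar>\<sigma>\<bar> = t \<Longrightarrow> lux_norm M UNIV (\<lambda>k. u k + \<sigma> * v k) \<le> ennreal R"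
      and vu: "\<And>\<sigma>. \<bar>\<sigma>\<bar> = t \<Longrightarrow> lux_norm M UNIV (\<lambda>k. v k + \<sigma> * u k) \<le> ennreal R"
      and nu: "\<not> lux_norm M UNIV u \<le> ennreal r" and nv: "\<not> lux_norm M UNIV v \<le> ennreal r"
      by (simp_all add: cubic_pair_def R_def r_def)
    define w where "w k = min \<bar>u k\<bar> \<bar>v k\<bar>" for k
    have w_R: "(\<Sum>k\<in>F. M (w k / R)) \<le> 60 * K * t" if F: "finite F" for F
    proof -
      let ?G = "{k\<in>F. \<bar>v k\<bar> \<le> \<bar>u k\<bar>}" and ?H = "{k\<in>F. \<bar>u k\<bar> \<le> \<bar>v k\<bar>}"
      have "(\<Sum>k\<in>F. M (w k / R)) \<le> (\<Sum>k\<in>?G \<union> ?H. M (w k / R))"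
        by (rule eq_refl, rule sum.cong) auto
      also have "\<dots> \<le> (\<Sum>k\<in>?G. M (w k / R)) + (\<Sum>k\<in>?H. M (w k / R))"
        using F R by (subst sum_Un) (auto intro!: sum_nonneg M_nonneg simp: w_def)
      also have "(\<Sum>k\<in>?G. M (w k / R)) = (\<Sum>k\<in>?G. M (\<bar>v k\<bar> / R))"
        by (rule sum.cong) (auto simp: w_def)
      also have "(\<Sum>k\<in>?H. M (w k / R)) = (\<Sum>k\<in>?H. M (\<bar>u k\<bar> / R))"
        by (rule sum.cong) (auto simp: w_def)
      finally show ?thesis
        using half[of u v, OF uv nu F]
          half[of v u, OF vu nv F] t by simp
    qed
    have w_\<epsilon>: "(\<Sum>k\<in>F. M (w k / \<epsilon>)) \<le> 1" if F: "finite F" for F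
    proof -
      have "M (w k / \<epsilon>) \<le> K' * M (w k / R)" for k
      proof -
        have wk: "0 \<le> w k / R" using R by (simp add: w_def)
        have "60 * K * t \<le> 60 * K * t * K'" using K K' t by simp
        then have "M (w k / R) \<le> 1" using w_R[of "{k}"] t_le by simp
        then have "M (L * (w k / R)) \<le> K' * M (w k / R)" by (intro K'(2) bdd[OF wk])
        moreover have "M (w k / \<epsilon>) \<le> M (L * (w k / R))"
        proof (rule orlicz_mono[OF orlicz])
          have "w k / \<epsilon> = (R / \<epsilon>) * (w k / R)" using R by simp
          also have "\<dots> \<le> L * (w k / R)"
          proof (rule mult_right_mono[OF _ wk])
            have "R / \<epsilon> \<le> 4 / \<epsilon>" using R \<open>\<epsilon> > 0\<close> by (intro divide_right_mono) auto
            then show "R / \<epsilon> \<le> L" by (simp add: L_def)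
          qed
          finally show "w k / \<epsilon> \<le> L * (w k / R)" .
        qed (use \<open>\<epsilon> > 0\<close> in \<open>simp add: w_def\<close>)
        ultimately show ?thesis by linarith
      qed
      then have "(\<Sum>k\<in>F. M (w k / \<epsilon>)) \<le> K' * (\<Sum>k\<in>F. M (w k / R))"
        by (simp add: sum_distrib_left sum_mono)
      also have "\<dots> \<le> K' * (60 * K * t)" using K' w_R[OF F] by (intro mult_left_mono) auto
      also have "\<dots> \<le> 1" using t_le by (simp add: mult_ac)
      finally show ?thesis .
    qed
    have close: "lux_norm M UNIV z \<le> ennreal \<epsilon>" if z: "\<And>k. \<bar>z k\<bar> \<le> w k" for z
    proof (subst lux_norm_le_iff[OF orlicz \<open>\<epsilon> > 0\<close>], intro allI impI)
      fix F :: "'i set" assume F: "finite F \<and> F \<subseteq> UNIV"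
      have "(\<Sum>k\<in>F. M (\<bar>z k\<bar> / \<epsilon>)) \<le> (\<Sum>k\<in>F. M (w k / \<epsilon>))"
        using z \<open>\<epsilon> > 0\<close> by (intro sum_mono orlicz_mono[OF orlicz]) (auto intro: divide_right_mono)
      then show "(\<Sum>k\<in>F. M (\<bar>z k\<bar> / \<epsilon>)) \<le> 1" using w_\<epsilon>[of F] F by linarith
    qed
    define u' v' where "u' k = (if \<bar>v k\<bar> \<le> \<bar>u k\<bar> then u k else 0)"
      and "v' k = (if \<bar>v k\<bar> \<le> \<bar>u k\<bar> then 0 else v k)" for k
    have "u' \<in> orlicz_space M UNIV" "v' \<in> orlicz_space M UNIV"
      by (rule orlicz_space_mono[OF orlicz u], simp add: u'_def)
         (rule orlicz_space_mono[OF orlicz v], simp add: v'_def)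
    moreover have "disjoint_vec u' v'" by (auto simp: disjoint_vec_def support_def u'_def v'_def)
    moreover have "lux_norm M UNIV (\<lambda>k. u k - u' k) \<le> ennreal \<epsilon>" "lux_norm M UNIV (\<lambda>k. v k - v' k) \<le> ennreal \<epsilon>"
      by (rule close; simp add: w_def u'_def v'_def)+
    ultimately show "\<exists>u'\<in>orlicz_space M UNIV. \<exists>v'\<in>orlicz_space M UNIV. disjoint_vec u' v' \<and>
        lux_norm M UNIV (\<lambda>k. u k - u' k) \<le> ennreal \<epsilon> \<and>
        lux_norm M UNIV (\<lambda>k. v k - v' k) \<le> ennreal \<epsilon>"
      by blast
  qed (use t in auto)
qed

end

lemma cubic_orlicz_hderiv:
  assumes "orlicz_function M" "C_halfline 3 M" "mono_on {0..} (hderiv 3 M)"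
    "M \<in> o[at_right 0](\<lambda>t. t ^ 3)"
  shows "cubic_orlicz M (hderiv 1 M) (hderiv 2 M) (hderiv 3 M)"
proof
  show "(M has_real_derivative hderiv 1 M s) (at s within {0..})"
    "(hderiv 1 M has_real_derivative hderiv 2 M s) (at s within {0..})"
    "(hderiv 2 M has_real_derivative hderiv 3 M s) (at s within {0..})" if "s \<ge> 0" for s
    using hderiv_has_derivative[OF assms(2), of 0 s] hderiv_has_derivative[OF assms(2), of 1 s]
      hderiv_has_derivative[OF assms(2), of 2 s] that
    by (simp_all add: eval_nat_numeral del: hderiv.simps(2))
qed (use assms in \<open>auto simp: C_halfline_def\<close>)

theorem theorem1p6:
  fixes M1 M2 :: "real \<Rightarrow> real" and I :: "nat set"
  assumes "orlicz_function M1" and "orlicz_function M2"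
    and "\<forall>M\<in>{M1, M2}. C_halfline 3 M \<and> mono_on {0..} (hderiv 3 M) \<and>
           M \<in> o[at_right 0](\<lambda>t. t ^ 3) \<and> Delta2pp_at_0 M"
    and "I = UNIV \<or> (\<exists>n. I = {1..n})"
  shows "\<forall>\<epsilon>>0. \<exists>\<delta>>0.
    \<forall>T\<in>Emb (1 + \<delta>) (orlicz_space M1 I) (lux_norm M1 I)
             (orlicz_space M2 (UNIV :: nat set)) (lux_norm M2 UNIV).
    \<forall>f\<in>orlicz_space M1 I. \<forall>g\<in>orlicz_space M1 I.
      lux_norm M1 I f \<le> 1 \<and> lux_norm M1 I g \<le> 1 \<and> disjoint_vec f g \<longrightarrow>
      (\<exists>f'\<in>orlicz_space M2 UNIV. \<exists>g'\<in>orlicz_space M2 UNIV.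
         disjoint_vec f' g' \<and>
         lux_norm M2 UNIV (\<lambda>k. T f k - f' k) \<le> ennreal \<epsilon> \<and>
         lux_norm M2 UNIV (\<lambda>k. T g k - g' k) \<le> ennreal \<epsilon>)"
proof (intro allI impI)
  fix \<epsilon> :: real assume \<epsilon>: "\<epsilon> > 0"
  have M12: "orlicz_function M1" "orlicz_function M2" by fact+
  interpret M1: cubic_orlicz M1 "hderiv 1 M1" "hderiv 2 M1" "hderiv 3 M1"
    using assms by (intro cubic_orlicz_hderiv) auto
  interpret M2: cubic_orlicz M2 "hderiv 1 M2" "hderiv 2 M2" "hderiv 3 M2"
    using assms by (intro cubic_orlicz_hderiv) auto
  have "Delta2pp_at_0 M2" using assms(3) by auto
  then have \<Delta>: "Limsup (at_right 0) (\<lambda>t. ereal (t * hderiv 1 M2 t / M2 t)) < \<infinity>"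
    "\<forall>\<^sub>F t in at_right 0. M2 t \<noteq> 0"
    unfolding Delta2pp_at_0_def by (simp_all del: hderiv.simps(2) One_nat_def)
  obtain t where t: "0 < t" "t \<le> 1"
    and split: "\<And>u v :: nat \<Rightarrow> real.
      u \<in> orlicz_space M2 UNIV \<Longrightarrow> v \<in> orlicz_space M2 UNIV \<Longrightarrow> cubic_pair M2 t u v \<Longrightarrow>
      \<exists>u'\<in>orlicz_space M2 UNIV. \<exists>v'\<in>orlicz_space M2 UNIV. disjoint_vec u' v' \<and>
        lux_norm M2 UNIV (\<lambda>k. u k - u' k) \<le> ennreal \<epsilon> \<and>
        lux_norm M2 UNIV (\<lambda>k. v k - v' k) \<le> ennreal \<epsilon>"
    using M2.almost_disjoint_images[where 'i = nat, OF M2.dilation_bound[OF \<Delta>] \<epsilon>] by blast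
  define C where "C = 1 + t ^ 3"
  have C: "1 < C" "C \<le> 2" using t power_le_one[of t 3] by (auto simp: C_def)
  let ?X = "orlicz_space M1 I" and ?Y = "orlicz_space M2 (UNIV :: nat set)"
  let ?p = "lux_norm M1 I" and ?q = "lux_norm M2 (UNIV :: nat set)"
  let ?goal = "\<lambda>T f g. \<exists>f'\<in>?Y. \<exists>g'\<in>?Y. disjoint_vec f' g' \<and>
    ?q (\<lambda>k. T f k - f' k) \<le> ennreal \<epsilon> \<and> ?q (\<lambda>k. T g k - g' k) \<le> ennreal \<epsilon>"
  show "\<exists>\<delta>>0. \<forall>T\<in>Emb (1 + \<delta>) ?X ?p ?Y ?q. \<forall>f\<in>?X. \<forall>g\<in>?X.
      ?p f \<le> 1 \<and> ?p g \<le> 1 \<and> disjoint_vec f g \<longrightarrow> ?goal T f g"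
  proof (intro exI[of _ "t ^ 3"] conjI ballI impI; (elim conjE)?)
    show "0 < t ^ 3" using t by simp
  next
    fix T f g
    assume T: "T \<in> Emb (1 + t ^ 3) ?X ?p ?Y ?q" and f: "f \<in> ?X" and g: "g \<in> ?X"
      and f1: "?p f \<le> 1" and g1: "?p g \<le> 1" and dis: "disjoint_vec f g"
    have C0: "C > 0" using C by simp
    note T_le = Emb_norm_le[OF M12 C0 T[folded C_def]]
    have TY: "T x \<in> ?Y" if "x \<in> ?X" for x using T that by (auto simp: Emb_def)
    have T_add: "T (\<lambda>k. x k + y k) = (\<lambda>j. T x j + T y j)" if "x \<in> ?X" "y \<in> ?X" for x y
      using T that by (auto simp: Emb_def linear_map_on_def)
    have T_scale: "T (\<lambda>k. a * x k) = (\<lambda>j. a * T x j)" if "x \<in> ?X" for a x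
      using T that by (auto simp: Emb_def linear_map_on_def)
    have zero: "?q (\<lambda>k. T x k - 0) \<le> ennreal \<epsilon>" if "x \<in> ?X" "?p x = 0" for x
    proof -
      have "?q (T x) \<le> ennreal (C * (\<epsilon> / C))" using that \<epsilon> C0 by (intro T_le(1)) auto
      then show ?thesis using C0 by simp
    qed
    have zero_mem: "(\<lambda>_. 0) \<in> ?Y"
      using orlicz_space_mono[OF M12(2) TY[OF f], of "\<lambda>_. 0"] by simp
    have self: "?q (\<lambda>k. T x k - T x k) \<le> ennreal \<epsilon>" for x
      using lux_norm_le_iff[OF M12(2) \<epsilon>, of UNIV "\<lambda>_. 0"] M2.M_0 by simp
    show "?goal T f g"
    proof (cases "?p f = 0 \<or> ?p g = 0")
      case True
      then show ?thesis
      proof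
        assume "?p f = 0"
        then show ?thesis using zero[OF f] self[of g] zero_mem TY[OF g]
          by (intro bexI[of _ "\<lambda>_. 0"] bexI[of _ "T g"]) (auto simp: disjoint_vec_def support_def)
      next
        assume "?p g = 0"
        then show ?thesis using zero[OF g] self[of f] zero_mem TY[OF f]
          by (intro bexI[of _ "\<lambda>_. 0"] bexI[of _ "T f"]) (auto simp: disjoint_vec_def support_def)
      qed
    next
      case False
      obtain a f0 where a: "0 < a" "a \<le> 1" and fa: "f = (\<lambda>k. a * f0 k)" and f0: "f0 \<in> ?X" "?p f0 \<le> 1"
        and f0_big: "\<And>r. 0 < r \<Longrightarrow> r < 1 \<Longrightarrow> \<not> ?p f0 \<le> ennreal r"
        using normalise[OF M12(1) f f1] False by metis
      obtain b g0 where b: "0 < b" "b \<le> 1" and gb: "g = (\<lambda>k. b * g0 k)" and g0: "g0 \<in> ?X" "?p g0 \<le> 1"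
        and g0_big: "\<And>r. 0 < r \<Longrightarrow> r < 1 \<Longrightarrow> \<not> ?p g0 \<le> ennreal r"
        using normalise[OF M12(1) g g1] False by metis
      have dis0: "disjoint_vec f0 g0" "disjoint_vec g0 f0"
        using dis a b by (auto simp: disjoint_vec_def support_def fa gb)
      have sum_le: "?q (\<lambda>k. T x k + \<sigma> * T y k) \<le> ennreal ((1 + t ^ 3)\<^sup>2)"
        if xy: "x \<in> ?X" "y \<in> ?X" "?p x \<le> 1" "?p y \<le> 1" "disjoint_vec x y" and \<sigma>: "\<bar>\<sigma>\<bar> = t" for x y \<sigma>
      proof -
        \<comment> \<open>The second bound, the case \<open>x = 0\<close>, only serves to place \<open>\<sigma> y\<close> in the domain of \<open>T\<close>.\<close>
        have le: "?p (\<lambda>k. x k + \<sigma> * y k) \<le> ennreal C" "?p (\<lambda>k. 0 * x k + \<sigma> * y k) \<le> ennreal C"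
          using M1.lux_norm_disjoint_sum[of I x y \<sigma>] M1.lux_norm_disjoint_sum[of I "\<lambda>_. 0" y \<sigma>] xy \<sigma> t
            lux_norm_le_iff[OF M12(1), of 1 I "\<lambda>_. 0"] M1.M_0
          by (auto simp: C_def disjoint_vec_def support_def)
        have sy: "(\<lambda>k. \<sigma> * y k) \<in> ?X" and sm: "(\<lambda>k. x k + \<sigma> * y k) \<in> ?X"
          using xy le C0 by (auto simp: orlicz_space_iff)
        have "?q (T (\<lambda>k. x k + \<sigma> * y k)) \<le> ennreal (C * C)" by (rule T_le(1)[OF sm C0 le(1)])
        then show ?thesis
          using T_add[OF xy(1) sy] T_scale[OF xy(2)] by (simp add: C_def power2_eq_square)
      qed
      have big: "\<not> ?q (T x) \<le> ennreal (1 / (1 + t ^ 3)\<^sup>2)"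
        if x: "x \<in> ?X" and x_big: "\<And>r. 0 < r \<Longrightarrow> r < 1 \<Longrightarrow> \<not> ?p x \<le> ennreal r" for x
      proof
        assume "?q (T x) \<le> ennreal (1 / (1 + t ^ 3)\<^sup>2)"
        then have "?p x \<le> ennreal (C * (1 / C\<^sup>2))" using C0 by (intro T_le(2)[OF x]) (auto simp: C_def)
        moreover have "C * (1 / C\<^sup>2) = 1 / C" by (simp add: power2_eq_square)
        ultimately show False using x_big[of "1 / C"] C by simp
      qed
      have "cubic_pair M2 t (T f0) (T g0)"
        using sum_le[OF f0(1) g0(1) f0(2) g0(2) dis0(1)] sum_le[OF g0(1) f0(1) g0(2) f0(2) dis0(2)]
          big[OF f0(1) f0_big] big[OF g0(1) g0_big]
        unfolding cubic_pair_def by blast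
      then obtain f' g' where f'g': "f' \<in> ?Y" "g' \<in> ?Y" "disjoint_vec f' g'"
        "?q (\<lambda>k. T f0 k - f' k) \<le> ennreal \<epsilon>" "?q (\<lambda>k. T g0 k - g' k) \<le> ennreal \<epsilon>"
        using split[OF TY[OF f0(1)] TY[OF g0(1)]] by blast
      have rescaled: "?q (\<lambda>k. c * T x k - c * z k) \<le> ennreal \<epsilon>"
        if "0 < c" "c \<le> 1" "?q (\<lambda>k. T x k - z k) \<le> ennreal \<epsilon>" for c x z
      proof (rule lux_norm_mono_le[OF M12(2) that(3) \<epsilon>])
        fix k
        have "\<bar>c * T x k - c * z k\<bar> = c * \<bar>T x k - z k\<bar>"
          using that by (simp add: abs_mult right_diff_distrib[symmetric])
        then show "\<bar>c * T x k - c * z k\<bar> \<le> \<bar>T x k - z k\<bar>" using that by (simp add: mult_left_le_one_le)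
      qed
      show ?thesis
      proof (intro bexI conjI)
        show "disjoint_vec (\<lambda>k. a * f' k) (\<lambda>k. b * g' k)"
          using f'g'(3) by (auto simp: disjoint_vec_def support_def)
        show "?q (\<lambda>k. T f k - a * f' k) \<le> ennreal \<epsilon>" "?q (\<lambda>k. T g k - b * g' k) \<le> ennreal \<epsilon>"
          using rescaled[OF a f'g'(4)] rescaled[OF b f'g'(5)] by (simp_all add: fa gb T_scale f0 g0)
        show "(\<lambda>k. a * f' k) \<in> ?Y" "(\<lambda>k. b * g' k) \<in> ?Y"
          using f'g'(1,2) a b by (auto intro: orlicz_space_scale[OF M12(2)])
      qed
    qed
  qed
qed

end
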